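(* Let $\beta>0$, $0<c<1$, $\lambda>0$, and put $\eta=1+\lambda\left(1-\frac1c\right)^2$. Let $\{S_n\}_{n\ge0}$ be the $\Delta$-Meixner-Sobolev orthogonal polynomials with parameters $\beta,c,\lambda$, let $\{q_n(\eta)\}_{n\ge0}$ be the associated sequence, and let $m_n(x;\beta-1,c)$ be the Meixner polynomials with parameter $\beta-1$ (all defined in the context). Then, as formal power series in $\omega$, $$\sum_{n=0}^{+\infty}q_n(\eta)\,S_n(x)\,\omega^n=\frac{1}{1-\omega}\sum_{n=0}^{+\infty}q_n(\eta)\,m_n(x;\beta-1,c)\,\omega^n .$$
   Context: $\Delta f(k)=f(k+1)-f(k)$; $(b)_0=1$, $(b)_k=b(b+1)\cdots(b+k-1)$. For every real $b$ and $c\ne0,1$ the Meixner polynomials are $m_n(x;b,c)=\sum_{k=0}^{n}\frac{(b+k)_{n-k}}{k!\,(n-k)!}(-x)_k\left(\frac1c-1\right)^k$, with leading coefficient $\frac1{n!}\left(1-\frac1c\right)^n$. $\{S_n\}_{n\ge0}$ is the sequence of polynomials ($\deg S_n=n$) orthogonal with respect to $(f,g)_S=\sum_{k\ge0}f(k)g(k)\frac{c^k(\beta)_k}{k!}+\lambda\sum_{k\ge0}\Delta f(k)\Delta g(k)\frac{c^k(\beta)_k}{k!}$, with $S_n$ having the same leading coefficient as $m_n(x;\beta,c)$. There are (uniquely determined) positive constants $a_n$, $n\ge0$, depending on $\beta,c,\lambda$, such that $m_n(x;\beta,c)-m_{n-1}(x;\beta,c)=S_n(x)-a_{n-1}S_{n-1}(x)$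 for $n\ge1$. The sequence $q_n(\eta)$ is defined by $q_0(\eta)=1$, $q_{n+1}(\eta)=q_n(\eta)/a_n$ for $n\ge0$. *)

theory Defs
  imports "HOL-Computational_Algebra.Computational_Algebra"
begin

definition meixner :: "nat \<Rightarrow> real \<Rightarrow> real \<Rightarrow> real poly" where
  "meixner n b c =
    (\<Sum>k\<le>n. smult (pochhammer (b + real k) (n - k) / (fact k * fact (n - k)) * (1 / c - 1) ^ k)
                  (pochhammer (- [:0, 1:]) k))"

definition fwd_diff :: "(real \<Rightarrow> real) \<Rightarrow> real \<Rightarrow> real" where
  "fwd_diff f x = f (x + 1) - f x"

definition meixner_weight :: "real \<Rightarrow> real \<Rightarrow> nat \<Rightarrow> real" where
  "meixner_weight \<beta> c k = c ^ k * pochhammer \<beta> k / fact k"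

(* Both series converge absolutely for 0 < c < 1. *)
definition meixner_sobolev_inner ::
    "real \<Rightarrow> real \<Rightarrow> real \<Rightarrow> real poly \<Rightarrow> real poly \<Rightarrow> real" where
  "meixner_sobolev_inner \<beta> c lam f g =
     (\<Sum>k. poly f (real k) * poly g (real k) * meixner_weight \<beta> c k)
     + lam * (\<Sum>k. fwd_diff (poly f) (real k) * fwd_diff (poly g) (real k) * meixner_weight \<beta> c k)"

definition is_meixner_sobolev_ops ::
    "real \<Rightarrow> real \<Rightarrow> real \<Rightarrow> (nat \<Rightarrow> real poly) \<Rightarrow> bool" where
  "is_meixner_sobolev_ops \<beta> c lam S \<longleftrightarrow>
     (\<forall>n. degree (S n) = n \<and> lead_coeff (S n) = lead_coeff (meixner n \<beta> c)) \<and>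
     (\<forall>m n. m \<noteq> n \<longrightarrow> meixner_sobolev_inner \<beta> c lam (S m) (S n) = 0)"

(* For \<beta> > 0, 0 < c < 1 and lam > 0 the form above is positive definite on polynomials,
   so exactly one sequence satisfies the description. *)
definition meixner_sobolev :: "real \<Rightarrow> real \<Rightarrow> real \<Rightarrow> nat \<Rightarrow> real poly" where
  "meixner_sobolev \<beta> c lam = (THE S. is_meixner_sobolev_ops \<beta> c lam S)"

definition meixner_sobolev_coeff :: "real \<Rightarrow> real \<Rightarrow> real \<Rightarrow> nat \<Rightarrow> real" where
  "meixner_sobolev_coeff \<beta> c lam n =
     (THE a. a > 0 \<and>
        meixner (Suc n) \<beta> c - meixner n \<beta> c
          = meixner_sobolev \<beta> c lam (Suc n) - smult a (meixner_sobolev \<beta> c lam n))"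

(* The sequence is indexed by \<eta> = 1 + lam * (1 - 1 / c)^2 instead of lam; the quotient
   in the recursion is the value of lam that belongs to \<eta>. *)
primrec meixner_sobolev_q :: "real \<Rightarrow> real \<Rightarrow> real \<Rightarrow> nat \<Rightarrow> real" where
  "meixner_sobolev_q \<beta> c \<eta> 0 = 1"
| "meixner_sobolev_q \<beta> c \<eta> (Suc n) =
     meixner_sobolev_q \<beta> c \<eta> n / meixner_sobolev_coeff \<beta> c ((\<eta> - 1) / (1 - 1 / c)\<^sup>2) n"

end

theory Submission
  imports Defs
begin

text \<open>The polynomials \<open>m\<^sub>n(x; \<beta>-1, c) = m\<^sub>n(x; \<beta>, c) - m\<^sub>n\<^sub>-\<^sub>1(x; \<beta>, c)\<close> have forward difference
  \<open>(1 - 1/c) m\<^sub>n\<^sub>-\<^sub>1(x; \<beta>, c)\<close>, so by orthogonality of the Meixner polynomials they are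
  Sobolev-orthogonal to every polynomial of degree at most \<open>n - 2\<close>.  Hence they equal
  \<open>S\<^sub>n - a\<^sub>n\<^sub>-\<^sub>1 S\<^sub>n\<^sub>-\<^sub>1\<close>, and pairing with \<open>S\<^sub>n\<^sub>-\<^sub>1\<close> shows that \<open>a\<^sub>n\<^sub>-\<^sub>1\<close> is a quotient of two
  squared norms.  Multiplying by \<open>q\<^sub>n\<close> turns this relation into
  \<open>q\<^sub>n m\<^sub>n(x; \<beta>-1, c) = q\<^sub>n S\<^sub>n - q\<^sub>n\<^sub>-\<^sub>1 S\<^sub>n\<^sub>-\<^sub>1\<close>, that is, into multiplication of the generating
  function by \<open>1 - \<omega>\<close>.\<close>

section \<open>Meixner polynomials in the Newton basis\<close>

definition diff_poly :: "real poly \<Rightarrow> real poly" where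
  "diff_poly p = pcompose p [:1, 1:] - p"

lemma poly_diff_poly: "poly (diff_poly p) x = fwd_diff (poly p) x"
  by (simp add: diff_poly_def fwd_diff_def poly_pcompose add.commute)

lemma smult_sum_right: "smult a (sum f A) = (\<Sum>i\<in>A. smult a (f i))"
  by (induction A rule: infinite_finite_induct) (simp_all add: smult_add_right)

lemma diff_poly_add: "diff_poly (p + q) = diff_poly p + diff_poly q"
  by (simp add: diff_poly_def pcompose_add)

lemma diff_poly_smult: "diff_poly (smult a p) = smult a (diff_poly p)"
  by (simp add: diff_poly_def pcompose_smult smult_diff_right)

lemma diff_poly_sum: "diff_poly (sum f A) = (\<Sum>i\<in>A. diff_poly (f i))"
  by (simp add: diff_poly_def pcompose_sum sum_subtractf)

lemma diff_poly_pCons: "diff_poly (pCons a p) = [:1, 1:] * diff_poly p + p"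
  by (simp add: diff_poly_def pcompose_pCons algebra_simps)

text \<open>Degree below \<open>n\<close> is expressed by vanishing coefficients, so that
  \<open>n = 0\<close> singles out the zero polynomial. By the rule for \<open>pCons\<close>, the
  induction multiplies a lower difference by \<open>x + 1\<close> and adds \<open>p\<close>, and
  both terms stay below the bound.\<close>

lemma coeff_diff_poly_eq_0:
  assumes "\<forall>i\<ge>Suc n. coeff p i = 0"
  shows "\<forall>i\<ge>n. coeff (diff_poly p) i = 0"
  using assms
proof (induction p arbitrary: n)
  case 0
  then show ?case by (simp add: diff_poly_def)
next
  case (pCons a p)
  have p: "coeff p i = 0" if "i \<ge> n" for i
    using pCons.prems that by (metis Suc_le_mono coeff_pCons_Suc)
  show ?case
  proof (cases n)
    case 0
    then have "p = 0"
      using p by (simp add: poly_eq_iff)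
    then show ?thesis by (simp add: diff_poly_def)
  next
    case (Suc m)
    then have "\<forall>i\<ge>m. coeff (diff_poly p) i = 0"
      using pCons.IH p by blast
    then show ?thesis
      using p Suc by (auto simp: diff_poly_pCons coeff_pCons split: nat.split)
  qed
qed

text \<open>Up to the sign \<open>(-1) ^ k\<close> this is the falling factorial, the basis on which
  the difference operator acts by lowering the index.\<close>

definition newton :: "nat \<Rightarrow> real poly" where
  "newton k = pochhammer (- [:0, 1:]) k"

lemma newton_0 [simp]: "newton 0 = 1"
  by (simp add: newton_def)

lemma newton_Suc: "newton (Suc k) = newton k * [:real k, -1:]"
  by (simp add: newton_def pochhammer_Suc of_nat_poly)

lemma meixner_newton:
  "meixner n b c = (\<Sum>k\<le>n. smult (pochhammer (b + real k) (n - k) / (fact k * fact (n - k))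
    * (1 / c - 1) ^ k) (newton k))"
  by (simp only: meixner_def newton_def)

lemma poly_newton: "poly (newton k) x = pochhammer (- x) k"
  by (induction k) (simp_all add: newton_Suc pochhammer_Suc algebra_simps)

lemma degree_newton: "degree (newton k) = k"
  and lead_coeff_newton: "coeff (newton k) k = (-1) ^ k"
proof -
  have "degree (newton k) = k \<and> coeff (newton k) k = (-1) ^ k"
  proof (induction k)
    case (Suc k)
    have "newton k \<noteq> 0"
      using Suc by auto
    then have d: "degree (newton (Suc k)) = Suc k"
      unfolding newton_Suc by (subst degree_mult_eq) (use Suc in auto)
    have "lead_coeff (newton (Suc k)) = lead_coeff (newton k) * (-1)"
      unfolding newton_Suc by (subst lead_coeff_mult) simp
    then show ?case
      using Suc d by simp
  qed simp
  then show "degree (newton k) = k" and "coeff (newton k) k = (-1) ^ k"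
    by auto
qed

text \<open>The two Pochhammer values share the factor \<open>pochhammer (- x) k\<close>; the
  remaining linear factors \<open>- (x + 1)\<close> and \<open>k - x\<close> differ by
  \<open>- (k + 1)\<close>.\<close>

lemma diff_poly_newton_Suc: "diff_poly (newton (Suc k)) = smult (- real (Suc k)) (newton k)"
proof (rule poly_ext)
  fix x :: real
  have "pochhammer (- (x + 1)) (Suc k) = - (x + 1) * pochhammer (- x) k"
    by (simp add: pochhammer_rec)
  moreover have "pochhammer (- x) (Suc k) = pochhammer (- x) k * (- x + real k)"
    by (simp add: pochhammer_Suc)
  ultimately show "poly (diff_poly (newton (Suc k))) x = poly (smult (- real (Suc k)) (newton k)) x"
    unfolding poly_diff_poly fwd_diff_def poly_newton poly_smult by (simp add: algebra_simps)
qed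

section \<open>Leading coefficient, parameter shift and difference of Meixner polynomials\<close>

lemma degree_meixner_le: "degree (meixner n b c) \<le> n"
  unfolding meixner_newton
  by (rule degree_sum_le) (auto intro: order.trans[OF degree_smult_le] simp: degree_newton)

text \<open>Only the term \<open>k = n\<close> reaches degree \<open>n\<close>. The value is
  independent of \<open>b\<close>, so lowering the parameter keeps the leading coefficient.\<close>

lemma coeff_meixner: "coeff (meixner n b c) n = (1 - 1 / c) ^ n / fact n"
proof -
  have "coeff (meixner n b c) n =
      (\<Sum>k\<le>n. if k = n then (1 / c - 1) ^ n * (-1) ^ n / fact n else 0)"
    unfolding meixner_newton coeff_sum
    by (intro sum.cong) (auto simp: lead_coeff_newton coeff_eq_0 degree_newton)
  also have "\<dots> = (1 - 1 / c) ^ n / fact n"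
    by (simp flip: power_mult_distrib)
  finally show ?thesis .
qed

lemma degree_meixner: "c \<noteq> 1 \<Longrightarrow> degree (meixner n b c) = n"
  using degree_meixner_le[of n b c] le_degree[of "meixner n b c" n]
  \<comment> \<open>Since \<open>1 / 0 = 0\<close>, the leading coefficient is also nonzero for
    \<open>c = 0\<close>.\<close>
  by (cases "c = 0") (auto simp: coeff_meixner)

lemma meixner_0 [simp]: "meixner 0 b c = 1"
  by (simp add: meixner_newton)

text \<open>In the Newton basis, with \<open>j = n - k\<close>, the identity reduces to
  \<open>(b + k + j) - (j + 1) = b - 1 + k\<close> after the common factor
  \<open>pochhammer (b + k) j\<close> is taken out.\<close>

lemma meixner_Suc_diff: "meixner (Suc n) b c - meixner n b c = meixner (Suc n) (b - 1) c"
proof -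
  define u where "u a m k = pochhammer (a + real k) (m - k) / (fact k * fact (m - k)) * (1 / c - 1) ^ k"
    for a m k
  have m: "meixner m a c = (\<Sum>k\<le>m. smult (u a m k) (newton k))" for m a
    by (simp add: meixner_newton u_def)
  have u: "u b (Suc n) k - u b n k = u (b - 1) (Suc n) k" if "k \<le> n" for k
  proof -
    define j where "j = n - k"
    have j: "n - k = j" "Suc n - k = Suc j"
      using that by (auto simp: j_def)
    have 1: "pochhammer (b + real k) (Suc j) = pochhammer (b + real k) j * (b + real k + real j)"
      by (simp add: pochhammer_Suc)
    have 2: "pochhammer (b - 1 + real k) (Suc j) = (b - 1 + real k) * pochhammer (b + real k) j"
      by (simp add: pochhammer_rec algebra_simps)
    show ?thesis
      unfolding u_def j 1 2 fact_Suc by (simp add: divide_simps) (simp add: algebra_simps)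
  qed
  have "u b (Suc n) (Suc n) = u (b - 1) (Suc n) (Suc n)"
    by (simp add: u_def)
  then show ?thesis
    unfolding m sum.atMost_Suc
    by (simp add: sum_subtractf[symmetric] smult_diff_left[symmetric])
      (intro sum.cong refl, simp add: u)
qed

text \<open>Lowering the Newton index turns \<open>b - 1\<close> into \<open>b\<close>, cancels
  \<open>k + 1\<close> against the factorial, and leaves one spare factor
  \<open>- (1 / c - 1)\<close>.\<close>

lemma diff_poly_meixner_Suc:
  "diff_poly (meixner (Suc n) (b - 1) c) = smult (1 - 1 / c) (meixner n b c)"
proof -
  define u where "u k = pochhammer (b - 1 + real k) (Suc n - k) / (fact k * fact (Suc n - k)) * (1 / c - 1) ^ k"
    for k
  have "diff_poly (meixner (Suc n) (b - 1) c) = (\<Sum>k\<le>Suc n. smult (u k) (diff_poly (newton k)))"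
    by (simp add: meixner_newton u_def diff_poly_sum diff_poly_smult del: sum.atMost_Suc)
  also have "\<dots> = (\<Sum>k\<le>n. smult (u (Suc k)) (diff_poly (newton (Suc k))))"
    unfolding sum.atMost_Suc_shift by (simp add: diff_poly_def pcompose_1)
  also have "\<dots> = (\<Sum>k\<le>n. smult (- real (Suc k) * u (Suc k)) (newton k))"
    by (simp only: diff_poly_newton_Suc smult_smult mult.commute)
  also have "\<dots> = smult (1 - 1 / c) (meixner n b c)"
    unfolding meixner_newton smult_sum_right smult_smult
  proof (intro sum.cong refl arg_cong2[where f = smult])
    fix k
    have r: "- ((1 / c - 1) ^ Suc k) = (1 - 1 / c) * (1 / c - 1) ^ k"
      by (simp add: algebra_simps)
    have "- real (Suc k) * u (Suc k)
        = pochhammer (b + real k) (n - k) / (fact k * fact (n - k)) * - ((1 / c - 1) ^ Suc k)"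
    proof -
      have b: "b - 1 + real (Suc k) = b + real k"
        by simp
      show ?thesis
        unfolding u_def fact_Suc b by (simp add: divide_simps del: power_Suc of_nat_Suc)
    qed
    then show "- real (Suc k) * u (Suc k) = (1 - 1 / c) *
        (pochhammer (b + real k) (n - k) / (fact k * fact (n - k)) * (1 / c - 1) ^ k)"
      unfolding r by simp
  qed
  finally show ?thesis .
qed

text \<open>The operator on the right is, up to the factor \<open>- c b\<close>, adjoint to \<open>diff_poly\<close> when the weights for
  \<open>b\<close> and \<open>b + 1\<close> are used on the two sides; this yields orthogonality by induction on the degree.\<close>

lemma meixner_raise:
  assumes "c \<noteq> 0"
  shows "smult (c * real (Suc n)) (meixner (Suc n) b c) =
    smult c ([:b, 1:] * meixner n (b + 1) c) - [:0, 1:] * pcompose (meixner n (b + 1) c) [:-1, 1:]"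
proof -
  define R where "R p = smult c ([:b, 1:] * p) - [:0, 1:] * pcompose p [:-1, 1:]" for p
  define r where "r = 1 / c - 1"
  define u where "u k = pochhammer (b + 1 + real k) (n - k) / (fact k * fact (n - k)) * r ^ k" for k
  define t where "t k = pochhammer (b + real k) (Suc n - k) / (fact k * fact (Suc n - k)) * r ^ k" for k
  have R_smult: "R (smult a p) = smult a (R p)" for a p
    by (rule poly_ext) (simp add: R_def poly_pcompose algebra_simps)
  have R_sum: "R (sum f A) = (\<Sum>i\<in>A. R (f i))" for f and A :: "nat set"
    by (rule poly_ext)
      (simp add: R_def poly_pcompose poly_sum sum_distrib_left sum_subtractf sum.distrib algebra_simps)
  \<comment> \<open>The shifted term again gives a Newton polynomial, because
    \<open>- x * pochhammer (1 - x) k = pochhammer (- x) (k + 1)\<close>.\<close>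
  have R_newton: "R (newton k) = smult (c * (b + real k)) (newton k) + smult (1 - c) (newton (Suc k))" for k
  proof (rule poly_ext)
    fix x :: real
    have 1: "pochhammer (- x) (Suc k) = - x * pochhammer (1 - x) k"
      by (simp add: pochhammer_rec)
    have 2: "pochhammer (- x) (Suc k) = pochhammer (- x) k * (- x + real k)"
      by (simp add: pochhammer_Suc)
    have "poly (R (newton k)) x = c * ((b + x) * pochhammer (- x) k) + (- x * pochhammer (1 - x) k)"
      by (simp add: R_def poly_pcompose poly_newton algebra_simps)
    also have "\<dots> = c * ((b + x) * pochhammer (- x) k) + pochhammer (- x) k * (- x + real k)"
      using 1 2 by simp
    finally show "poly (R (newton k)) x
        = poly (smult (c * (b + real k)) (newton k) + smult (1 - c) (newton (Suc k))) x"
      unfolding poly_add poly_smult poly_newton 2 by (simp add: algebra_simps)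
  qed
  \<comment> \<open>The target coefficient of \<open>newton k\<close> is split in the proportion
    \<open>Suc n - k\<close> to \<open>k\<close>: \<open>low\<close> is the share from the diagonal
    part of \<open>R_newton\<close>, \<open>high\<close> the share from its index-raising
    part.\<close>
  have low: "u k * (c * (b + real k)) = c * real (Suc n - k) * t k" if "k \<le> n" for k
  proof -
    define j where "j = n - k"
    have j: "n - k = j" "Suc n - k = Suc j"
      using that by (auto simp: j_def)
    have 1: "pochhammer (b + real k) (Suc j) = (b + real k) * pochhammer (b + 1 + real k) j"
      by (simp add: pochhammer_rec algebra_simps)
    show ?thesis
      unfolding u_def t_def j 1 fact_Suc by (simp add: divide_simps)
  qed
  have high: "u k * (1 - c) = c * real (Suc k) * t (Suc k)" for k
  proof -
    have 1: "r ^ Suc k * c = r ^ k * (1 - c)"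
      using assms by (simp add: r_def field_simps)
    have 2: "b + real (Suc k) = b + 1 + real k" "Suc n - Suc k = n - k"
      by simp_all
    have "c * real (Suc k) * t (Suc k)
        = pochhammer (b + 1 + real k) (n - k) / (fact k * fact (n - k)) * (r ^ Suc k * c)"
      unfolding t_def 2 fact_Suc by (simp add: divide_simps del: power_Suc)
    then show ?thesis
      unfolding u_def 1 by simp
  qed
  have "R (meixner n (b + 1) c) = (\<Sum>k\<le>n. smult (u k) (R (newton k)))"
    by (simp add: meixner_newton R_sum R_smult u_def r_def)
  also have "\<dots> = (\<Sum>k\<le>n. smult (u k * (c * (b + real k))) (newton k))
      + (\<Sum>k\<le>n. smult (u k * (1 - c)) (newton (Suc k)))"
    unfolding R_newton smult_add_right smult_smult sum.distrib ..
  \<comment> \<open>Both sums extend to \<open>Suc n\<close>: the term added here carries the factor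
    \<open>Suc n - k = 0\<close>, the one added in the next sum the factor
    \<open>k = 0\<close>.\<close>
  also have "(\<Sum>k\<le>n. smult (u k * (c * (b + real k))) (newton k))
      = (\<Sum>k\<le>Suc n. smult (c * real (Suc n - k) * t k) (newton k))"
    by (simp add: low)
  also have "(\<Sum>k\<le>n. smult (u k * (1 - c)) (newton (Suc k)))
      = (\<Sum>k\<le>Suc n. smult (c * real k * t k) (newton k))"
    unfolding high sum.atMost_Suc_shift by simp
  also have "(\<Sum>k\<le>Suc n. smult (c * real (Suc n - k) * t k) (newton k))
      + (\<Sum>k\<le>Suc n. smult (c * real k * t k) (newton k))
      = (\<Sum>k\<le>Suc n. smult (c * real (Suc n) * t k) (newton k))"
    unfolding sum.distrib[symmetric] smult_add_left[symmetric]
  proof (intro sum.cong refl arg_cong2[where f = smult])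
    fix k assume "k \<in> {..Suc n}"
    then have "real (Suc n - k) = real (Suc n) - real k"
      by (intro of_nat_diff) simp
    then show "c * real (Suc n - k) * t k + c * real k * t k = c * real (Suc n) * t k"
      by (simp add: algebra_simps)
  qed
  also have "\<dots> = smult (c * real (Suc n)) (meixner (Suc n) b c)"
    unfolding meixner_newton smult_sum_right smult_smult t_def r_def by simp
  finally show ?thesis
    by (simp add: R_def)
qed

section \<open>The Meixner functional\<close>

definition meixner_functional :: "real \<Rightarrow> real \<Rightarrow> real poly \<Rightarrow> real" where
  "meixner_functional \<beta> c p = (\<Sum>k. poly p (real k) * meixner_weight \<beta> c k)"

section \<open>Weights: positivity, shift relations and summability\<close>

lemma meixner_weight_pos: "\<beta> > 0 \<Longrightarrow> c > 0 \<Longrightarrow> meixner_weight \<beta> c k > 0"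
  by (simp add: meixner_weight_def pochhammer_pos)

lemma meixner_weight_shift_param:
  "(\<beta> + real k) * meixner_weight \<beta> c k = \<beta> * meixner_weight (\<beta> + 1) c k"
proof -
  have "pochhammer \<beta> k * (\<beta> + real k) = \<beta> * pochhammer (\<beta> + 1) k"
    by (metis pochhammer_Suc pochhammer_rec)
  then show ?thesis
    by (simp add: meixner_weight_def divide_simps mult.commute mult.left_commute)
qed

text \<open>Together with the previous relation this gives the ratio of consecutive weights, since
  both lead to the same weight for \<open>\<beta> + 1\<close>.\<close>

lemma meixner_weight_Suc:
  "real (Suc k) * meixner_weight \<beta> c (Suc k) = c * \<beta> * meixner_weight (\<beta> + 1) c k"
  unfolding meixner_weight_def pochhammer_rec fact_Suc power_Suc
  by (simp add: divide_simps)

lemma summable_meixner_weight: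
  assumes "\<beta> > 0" "0 < c" "c < 1"
  shows "summable (meixner_weight \<beta> c)"
proof -
  \<comment> \<open>The ratio \<open>c * (\<beta> + n) / (n + 1)\<close> tends to \<open>c\<close>.
    This bound makes it at most the midpoint \<open>(1 + c) / 2 < 1\<close> for
    \<open>n \<ge> N\<close>.\<close>
  obtain N where N: "real N > (c * \<beta>) * 2 / (1 - c)"
    using reals_Archimedean2 by blast
  show ?thesis
  proof (rule summable_ratio_test[where c = "(1 + c) / 2" and N = N])
    fix n assume "N \<le> n"
    then have "real n > (c * \<beta>) * 2 / (1 - c)"
      using N by linarith
    then have n: "real n * (1 - c) > 2 * (c * \<beta>)"
      using assms by (simp add: divide_simps mult.commute)
    have pos: "meixner_weight \<beta> c n > 0" "meixner_weight \<beta> c (Suc n) > 0"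
      using assms by (auto simp: meixner_weight_pos)
    have "real (Suc n) * meixner_weight \<beta> c (Suc n) = c * (\<beta> + real n) * meixner_weight \<beta> c n"
      using meixner_weight_Suc meixner_weight_shift_param by (metis mult.assoc)
    also have "\<dots> \<le> (real (Suc n) * ((1 + c) / 2)) * meixner_weight \<beta> c n"
      using n pos assms by (intro mult_right_mono) (auto simp: algebra_simps)
    finally show "norm (meixner_weight \<beta> c (Suc n)) \<le> (1 + c) / 2 * norm (meixner_weight \<beta> c n)"
      using pos by (simp add: mult.assoc)
  qed (use assms in auto)
qed

text \<open>Induction on the degree with varying \<open>\<beta>\<close>: dividing \<open>p\<close>
  by \<open>x + \<beta>\<close> leaves a constant, and the linear factor is absorbed by passing to
  the weight for \<open>\<beta> + 1\<close>.\<close>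

lemma summable_meixner:
  assumes "\<beta> > 0" "0 < c" "c < 1"
  shows "summable (\<lambda>k. poly p (real k) * meixner_weight \<beta> c k)"
  using assms(1)
proof (induction "degree p" arbitrary: p \<beta> rule: less_induct)
  case less
  define q where "q = synthetic_div p (- \<beta>)"
  define a where "a = poly p (- \<beta>)"
  have p: "p = [:\<beta>, 1:] * q + [:a:]"
    using synthetic_div_correct'[of "- \<beta>" p] by (simp add: q_def a_def)
  have const: "summable (\<lambda>k. a * meixner_weight \<beta> c k)"
    using summable_meixner_weight[OF less.prems assms(2,3)] by (rule summable_mult)
  show ?case
  proof (cases "degree p = 0")
    case True
    then obtain d where "p = [:d:]"
      by (metis degree_eq_zeroE)
    then show ?thesis
      using summable_mult[OF summable_meixner_weight[OF less.prems assms(2,3)]] by simp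
  next
    case False
    then have "degree q < degree p"
      by (simp add: q_def degree_synthetic_div)
    then have "summable (\<lambda>k. \<beta> * (poly q (real k) * meixner_weight (\<beta> + 1) c k) + a * meixner_weight \<beta> c k)"
      using less.hyps[of q "\<beta> + 1"] less.prems by (intro summable_add summable_mult const) auto
    moreover have "\<beta> * (poly q (real k) * meixner_weight (\<beta> + 1) c k) + a * meixner_weight \<beta> c k
        = poly p (real k) * meixner_weight \<beta> c k" for k
    proof -
      have "poly p (real k) * meixner_weight \<beta> c k
          = poly q (real k) * ((\<beta> + real k) * meixner_weight \<beta> c k) + a * meixner_weight \<beta> c k"
        by (subst p) (simp add: algebra_simps)
      then show ?thesis
        by (simp add: meixner_weight_shift_param)
    qed
    ultimately show ?thesis by simp
  qed
qed

section \<open>Linearity, positivity and shifts of the functional\<close>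

context
  fixes \<beta> c :: real
  assumes \<beta>: "\<beta> > 0" and c: "0 < c" "c < 1"
begin

lemma meixner_functional_add:
  "meixner_functional \<beta> c (p + q) = meixner_functional \<beta> c p + meixner_functional \<beta> c q"
  unfolding meixner_functional_def
  by (subst suminf_add) (auto simp: summable_meixner \<beta> c distrib_right)

lemma meixner_functional_smult:
  "meixner_functional \<beta> c (smult a p) = a * meixner_functional \<beta> c p"
  unfolding meixner_functional_def
  by (subst suminf_mult[symmetric]) (auto simp: summable_meixner \<beta> c mult.assoc)

lemma meixner_functional_diff:
  "meixner_functional \<beta> c (p - q) = meixner_functional \<beta> c p - meixner_functional \<beta> c q"
  using meixner_functional_add[of p "smult (-1) q"] unfolding meixner_functional_smult by simp

lemma meixner_functional_square_nonneg: "meixner_functional \<beta> c (p * p) \<ge> 0"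
  unfolding meixner_functional_def
  by (intro suminf_nonneg summable_meixner \<beta> c)
    (simp add: meixner_weight_pos \<beta> c less_imp_le)

text \<open>A nonzero polynomial has finitely many roots, so some natural number is not a root; its
  term is positive and no term is negative.\<close>

lemma meixner_functional_square_pos:
  assumes "p \<noteq> 0"
  shows "meixner_functional \<beta> c (p * p) > 0"
proof -
  have "finite {x. poly p x = 0}"
    using assms by (rule poly_roots_finite)
  moreover have "infinite (range real)"
    by (simp add: finite_image_iff inj_on_def)
  ultimately obtain k where "poly p (real k) \<noteq> 0"
    by (metis (mono_tags, lifting) finite_subset image_subsetI mem_Collect_eq)
  then have "0 < poly (p * p) (real k) * meixner_weight \<beta> c k"
    by (simp add: meixner_weight_pos \<beta> c zero_less_mult_iff linorder_neq_iff[symmetric])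
  then show ?thesis
    unfolding meixner_functional_def
    by (intro suminf_pos2[where i = k] summable_meixner \<beta> c)
      (simp_all add: meixner_weight_pos \<beta> c less_imp_le)
qed

lemma meixner_functional_shift_param:
  "meixner_functional \<beta> c ([:\<beta>, 1:] * p) = \<beta> * meixner_functional (\<beta> + 1) c p"
proof -
  have "poly ([:\<beta>, 1:] * p) (real k) * meixner_weight \<beta> c k
      = \<beta> * (poly p (real k) * meixner_weight (\<beta> + 1) c k)" for k
  proof -
    have "poly ([:\<beta>, 1:] * p) (real k) * meixner_weight \<beta> c k
        = poly p (real k) * ((\<beta> + real k) * meixner_weight \<beta> c k)"
      by (simp add: algebra_simps)
    then show ?thesis
      by (simp add: meixner_weight_shift_param)
  qed
  then show ?thesis
    unfolding meixner_functional_def using \<beta> c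
    by (simp add: suminf_mult summable_meixner)
qed

lemma meixner_functional_mult_X:
  "meixner_functional \<beta> c ([:0, 1:] * p) = c * \<beta> * meixner_functional (\<beta> + 1) c (pcompose p [:1, 1:])"
proof -
  let ?t = "\<lambda>k. poly ([:0, 1:] * p) (real k) * meixner_weight \<beta> c k"
  have t: "?t (Suc k) = c * \<beta> * (poly (pcompose p [:1, 1:]) (real k) * meixner_weight (\<beta> + 1) c k)" for k
  proof -
    have "?t (Suc k) = poly p (real (Suc k)) * (real (Suc k) * meixner_weight \<beta> c (Suc k))"
      by (simp del: of_nat_Suc)
    then show ?thesis
      unfolding meixner_weight_Suc by (simp add: poly_pcompose add.commute)
  qed
  \<comment> \<open>The factor \<open>x\<close> kills the term at \<open>0\<close>, so the series
    may start at \<open>1\<close>.\<close>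
  have "suminf ?t = (\<Sum>k. ?t (Suc k))"
    using suminf_split_head[OF summable_meixner[OF \<beta> c, of "[:0, 1:] * p"]] by simp
  then show ?thesis
    unfolding meixner_functional_def t using \<beta> c
    by (simp add: suminf_mult summable_meixner)
qed

end

text \<open>\<open>meixner_raise\<close> moves a difference onto \<open>p\<close> and raises the
  parameter to \<open>\<beta> + 1\<close>. Hence \<open>\<beta>\<close> varies in the induction,
  while the degree bound on \<open>p\<close> drops along with \<open>n\<close>.\<close>

lemma meixner_orthogonal:
  assumes "\<beta> > 0" "0 < c" "c < 1" and "\<forall>i\<ge>n. coeff p i = 0"
  shows "meixner_functional \<beta> c (meixner n \<beta> c * p) = 0"
  using assms(1,4)
proof (induction n arbitrary: \<beta> p)
  case 0
  then have "p = 0"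
    by (simp add: poly_eq_iff)
  then show ?case
    by (simp add: meixner_functional_def)
next
  case (Suc n)
  note c = assms(2,3)
  let ?f = "meixner n (\<beta> + 1) c"
  have "c * real (Suc n) * meixner_functional \<beta> c (meixner (Suc n) \<beta> c * p)
      = meixner_functional \<beta> c (smult (c * real (Suc n)) (meixner (Suc n) \<beta> c) * p)"
    using Suc.prems c by (simp add: meixner_functional_smult)
  also have "\<dots> = meixner_functional \<beta> c
      (smult c ([:\<beta>, 1:] * (?f * p)) - [:0, 1:] * (pcompose ?f [:-1, 1:] * p))"
    using c by (subst meixner_raise) (simp_all add: algebra_simps)
  also have "\<dots> = c * \<beta> * meixner_functional (\<beta> + 1) c (?f * p)
      - c * \<beta> * meixner_functional (\<beta> + 1) c (pcompose (pcompose ?f [:-1, 1:] * p) [:1, 1:])"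
    unfolding meixner_functional_diff[OF Suc.prems(1) c] meixner_functional_smult[OF Suc.prems(1) c]
      meixner_functional_shift_param[OF Suc.prems(1) c] meixner_functional_mult_X[OF Suc.prems(1) c]
    by simp
  \<comment> \<open>The forward shift undoes the backward shift of the Meixner factor and falls on
    \<open>p\<close> instead, which produces \<open>diff_poly p\<close>.\<close>
  also have "pcompose (pcompose ?f [:-1, 1:] * p) [:1, 1:] = ?f * pcompose p [:1, 1:]"
    by (simp add: pcompose_mult pcompose_assoc[symmetric] pcompose_pCons)
  also have "c * \<beta> * meixner_functional (\<beta> + 1) c (?f * p)
      - c * \<beta> * meixner_functional (\<beta> + 1) c (?f * pcompose p [:1, 1:])
      = - (c * \<beta>) * meixner_functional (\<beta> + 1) c (?f * diff_poly p)"
    using Suc.prems(1) c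
    by (simp add: diff_poly_def right_diff_distrib meixner_functional_diff)
  also have "\<dots> = 0"
    using Suc.IH[of "\<beta> + 1" "diff_poly p"] Suc.prems coeff_diff_poly_eq_0 by simp
  finally show ?case
    using c by simp
qed

section \<open>Orthogonal polynomials for a positive definite form\<close>

text \<open>These properties suffice for Gram-Schmidt, so that argument is kept free of series and
  convergence.\<close>

locale pos_def_poly_form =
  fixes B :: "real poly \<Rightarrow> real poly \<Rightarrow> real"
  assumes sym: "B p q = B q p"
    and add_left: "B (p + q) r = B p r + B q r"
    and smult_left: "B (smult a p) q = a * B p q"
    and pos: "p \<noteq> 0 \<Longrightarrow> B p p > 0"
begin

lemma diff_left: "B (p - q) r = B p r - B q r"
  using add_left[of p "smult (-1) q" r] unfolding smult_left by simp

lemma add_right: "B r (p + q) = B r p + B r q"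
  by (metis add_left sym)

lemma smult_right: "B q (smult a p) = a * B q p"
  by (metis smult_left sym)

lemma zero_left [simp]: "B 0 p = 0"
  using smult_left[of 0 0 p] by simp

lemma zero_right [simp]: "B p 0 = 0"
  by (metis sym zero_left)

lemma self_eq_0_iff: "B p p = 0 \<longleftrightarrow> p = 0"
  using pos by (metis less_irrefl zero_left)

text \<open>\<open>h\<close> is the orthogonal projection of \<open>f\<close> to degree below
  \<open>n\<close>. The induction hypothesis is used twice: on \<open>monom 1 n\<close> it yields a
  monic \<open>e\<close> orthogonal to lower degrees, and on \<open>f\<close> a projection that is
  then corrected along \<open>e\<close>.\<close>

lemma ex_projection:
  "\<exists>h. (\<forall>i\<ge>n. coeff h i = 0) \<and> (\<forall>g. (\<forall>i\<ge>n. coeff g i = 0) \<longrightarrow> B (f - h) g = 0)"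
proof (induction n arbitrary: f)
  case 0
  have "g = 0" if "\<forall>i\<ge>0. coeff g i = 0" for g :: "real poly"
    using that by (simp add: poly_eq_iff)
  then show ?case
    by (intro exI[of _ 0]) (metis coeff_0 zero_right)
next
  case (Suc n)
  obtain h0 where h0: "\<forall>i\<ge>n. coeff h0 i = 0"
      "\<And>g. \<forall>i\<ge>n. coeff g i = 0 \<Longrightarrow> B (monom 1 n - h0) g = 0"
    using Suc.IH by blast
  obtain h1 where h1: "\<forall>i\<ge>n. coeff h1 i = 0"
      "\<And>g. \<forall>i\<ge>n. coeff g i = 0 \<Longrightarrow> B (f - h1) g = 0"
    using Suc.IH by blast
  define e where "e = monom 1 n - h0"
  have e: "coeff e n = 1" "\<And>i. i > n \<Longrightarrow> coeff e i = 0"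
    using h0(1) by (auto simp: e_def)
  then have "e \<noteq> 0"
    by auto
  then have Be: "B e e \<noteq> 0"
    by (simp add: self_eq_0_iff)
  define h where "h = h1 + smult (B (f - h1) e / B e e) e"
  have fh: "f - h = (f - h1) - smult (B (f - h1) e / B e e) e"
    by (simp add: h_def)
  have "B (f - h) g = 0" if g: "\<forall>i\<ge>Suc n. coeff g i = 0" for g
  proof -
    define r where "r = g - smult (coeff g n) e"
    have "coeff r i = 0" if "i \<ge> n" for i
      using that g e by (cases "i = n") (auto simp: r_def)
    then have "B (f - h1) r = 0" "B e r = 0"
      using h1(2) h0(2) by (auto simp: e_def)
    then have "B (f - h) r = 0"
      unfolding fh diff_left smult_left by simp
    moreover have "B (f - h) e = 0"
      unfolding fh diff_left[of _ "smult _ _"] smult_left using Be by simp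
    moreover have "g = r + smult (coeff g n) e"
      by (simp add: r_def)
    ultimately show ?thesis
      by (metis add_right smult_right add.right_neutral mult_zero_right)
  qed
  moreover have "\<forall>i\<ge>Suc n. coeff h i = 0"
    using h1(1) e(2) by (auto simp: h_def)
  ultimately show ?case by blast
qed

definition ops :: "(nat \<Rightarrow> real) \<Rightarrow> (nat \<Rightarrow> real poly) \<Rightarrow> bool" where
  "ops \<kappa> S \<longleftrightarrow> (\<forall>n. degree (S n) = n \<and> lead_coeff (S n) = \<kappa> n) \<and>
     (\<forall>m n. m \<noteq> n \<longrightarrow> B (S m) (S n) = 0)"

text \<open>As \<open>\<kappa>\<close> never vanishes, leading terms of \<open>g\<close> can be
  removed by multiples of \<open>S m\<close> with \<open>m < n\<close>, all orthogonal to
  \<open>S n\<close>.\<close>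

lemma ops_orthogonal_lower:
  assumes S: "ops \<kappa> S" and \<kappa>: "\<And>n. \<kappa> n \<noteq> 0" and "\<forall>i\<ge>n. coeff g i = 0"
  shows "B (S n) g = 0"
proof -
  have "B (S n) g = 0" if "m \<le> n" "\<forall>i\<ge>m. coeff g i = 0" for m
    using that
  proof (induction m arbitrary: g)
    case 0
    then have "g = 0"
      by (simp add: poly_eq_iff)
    then show ?case by simp
  next
    case (Suc m)
    have deg: "degree (S m) = m" and lc: "coeff (S m) m = \<kappa> m"
      using S unfolding ops_def by metis+
    define r where "r = g - smult (coeff g m / \<kappa> m) (S m)"
    have "coeff r i = 0" if "i \<ge> m" for i
      using that Suc.prems(2) deg lc \<kappa>[of m]
      by (cases "i = m") (auto simp: r_def coeff_eq_0)
    then have "B (S n) r = 0"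
      using Suc.IH Suc.prems(1) by simp
    moreover have "B (S n) (S m) = 0"
      using S Suc.prems(1) by (simp add: ops_def)
    moreover have "g = r + smult (coeff g m / \<kappa> m) (S m)"
      by (simp add: r_def)
    ultimately show ?case
      by (metis add_right smult_right add.right_neutral mult_zero_right)
  qed
  then show ?thesis
    using assms(3) by blast
qed

lemma ex1_ops:
  assumes \<kappa>: "\<And>n. \<kappa> n \<noteq> 0"
  shows "\<exists>!S. ops \<kappa> S"
proof -
  \<comment> \<open>Orthogonality to all lower degrees does not mention the other members of the
    sequence, so each \<open>S n\<close> can be chosen separately.\<close>
  have "\<exists>p. degree p = n \<and> lead_coeff p = \<kappa> n \<and> (\<forall>g. (\<forall>i\<ge>n. coeff g i = 0) \<longrightarrow> B p g = 0)" for n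
  proof -
    obtain h where h: "\<forall>i\<ge>n. coeff h i = 0"
        "\<forall>g. (\<forall>i\<ge>n. coeff g i = 0) \<longrightarrow> B (monom (\<kappa> n) n - h) g = 0"
      using ex_projection by blast
    have co: "coeff (monom (\<kappa> n) n - h) n = \<kappa> n"
      using h(1) by simp
    have "degree (monom (\<kappa> n) n - h) \<le> n"
      using h(1) by (intro degree_le) auto
    moreover have "degree (monom (\<kappa> n) n - h) \<ge> n"
      using co \<kappa>[of n] by (intro le_degree) simp
    ultimately have "degree (monom (\<kappa> n) n - h) = n"
      by simp
    then show ?thesis
      using co h(2) by metis
  qed
  then obtain S where S: "\<And>n. degree (S n) = n" "\<And>n. lead_coeff (S n) = \<kappa> n"
      "\<And>n g. \<forall>i\<ge>n. coeff g i = 0 \<Longrightarrow> B (S n) g = 0"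
    by metis
  have "B (S m) (S n) = 0" if "m \<noteq> n" for m n
  proof (cases "m < n")
    case True
    then have "B (S n) (S m) = 0"
      by (intro S(3)) (simp add: coeff_eq_0 S(1))
    then show ?thesis by (simp add: sym)
  next
    case False
    then show ?thesis
      using that by (intro S(3)) (simp add: coeff_eq_0 S(1))
  qed
  then have "ops \<kappa> S"
    using S by (simp add: ops_def)
  moreover have "T = S" if T: "ops \<kappa> T" for T
  proof
    fix n
    have deg: "degree (S n) = n" "degree (T n) = n" and lc: "coeff (S n) n = \<kappa> n" "coeff (T n) n = \<kappa> n"
      using S(1,2) T unfolding ops_def by metis+
    \<comment> \<open>Equal leading coefficients put \<open>d\<close> in degree below
      \<open>n\<close>, so \<open>d\<close> is orthogonal to both \<open>T n\<close> and
      \<open>S n\<close>, hence to itself.\<close>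
    define d where "d = T n - S n"
    have d: "\<forall>i\<ge>n. coeff d i = 0"
    proof (intro allI impI)
      fix i assume "n \<le> i"
      then show "coeff d i = 0"
        by (cases "i = n") (simp_all add: d_def lc deg coeff_eq_0)
    qed
    have "B (T n) d = 0" "B (S n) d = 0"
      using ops_orthogonal_lower[OF T \<kappa> d] S(3)[OF d] by auto
    then have "B d d = 0"
      by (simp add: d_def diff_left)
    then show "T n = S n"
      by (simp add: self_eq_0_iff d_def)
  qed
  ultimately show ?thesis by blast
qed

end

section \<open>Meixner--Sobolev polynomials\<close>

lemma meixner_sobolev_inner_eq:
  "meixner_sobolev_inner \<beta> c lam p q =
    meixner_functional \<beta> c (p * q) + lam * meixner_functional \<beta> c (diff_poly p * diff_poly q)"
  by (simp add: meixner_sobolev_inner_def meixner_functional_def poly_diff_poly)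

context
  fixes \<beta> c lam :: real
  assumes \<beta>: "\<beta> > 0" and c: "0 < c" "c < 1" and lam: "lam > 0"
begin

interpretation pos_def_poly_form "meixner_sobolev_inner \<beta> c lam"
proof
  fix p q r :: "real poly" and a :: real
  show "meixner_sobolev_inner \<beta> c lam p q = meixner_sobolev_inner \<beta> c lam q p"
    by (simp add: meixner_sobolev_inner_eq mult.commute)
  show "meixner_sobolev_inner \<beta> c lam (p + q) r
      = meixner_sobolev_inner \<beta> c lam p r + meixner_sobolev_inner \<beta> c lam q r"
    using \<beta> c by (simp add: meixner_sobolev_inner_eq diff_poly_add distrib_right
        meixner_functional_add distrib_left)
  show "meixner_sobolev_inner \<beta> c lam (smult a p) q = a * meixner_sobolev_inner \<beta> c lam p q"
    using \<beta> c by (simp add: meixner_sobolev_inner_eq diff_poly_smult meixner_functional_smult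
        distrib_left)
  assume "p \<noteq> 0"
  then show "meixner_sobolev_inner \<beta> c lam p p > 0"
    unfolding meixner_sobolev_inner_eq using \<beta> c lam
    by (intro add_pos_nonneg meixner_functional_square_pos mult_nonneg_nonneg
        meixner_functional_square_nonneg) auto
qed

lemma is_meixner_sobolev_ops_meixner_sobolev:
  "is_meixner_sobolev_ops \<beta> c lam (meixner_sobolev \<beta> c lam)"
proof -
  have "meixner n \<beta> c \<noteq> 0" for n
    using c coeff_meixner[of n \<beta> c] by auto
  then have "\<exists>!S. ops (\<lambda>n. lead_coeff (meixner n \<beta> c)) S"
    by (intro ex1_ops) simp
  then show ?thesis
    unfolding meixner_sobolev_def ops_def is_meixner_sobolev_ops_def[symmetric] by (rule theI')
qed

lemma degree_meixner_sobolev: "degree (meixner_sobolev \<beta> c lam n) = n"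
  and coeff_meixner_sobolev: "coeff (meixner_sobolev \<beta> c lam n) n = (1 - 1 / c) ^ n / fact n"
proof -
  have "degree (meixner n \<beta> c) = n"
    using c by (intro degree_meixner) simp
  then show "degree (meixner_sobolev \<beta> c lam n) = n"
    and "coeff (meixner_sobolev \<beta> c lam n) n = (1 - 1 / c) ^ n / fact n"
    using is_meixner_sobolev_ops_meixner_sobolev
    unfolding is_meixner_sobolev_ops_def by (metis coeff_meixner)+
qed

lemma meixner_sobolev_nonzero: "meixner_sobolev \<beta> c lam n \<noteq> 0"
  using c coeff_meixner_sobolev[of n] by auto

lemma meixner_sobolev_orthogonal_lower:
  assumes "\<forall>i\<ge>n. coeff g i = 0"
  shows "meixner_sobolev_inner \<beta> c lam (meixner_sobolev \<beta> c lam n) g = 0"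
proof (rule ops_orthogonal_lower[OF _ _ assms])
  show "ops (\<lambda>n. lead_coeff (meixner n \<beta> c)) (meixner_sobolev \<beta> c lam)"
    using is_meixner_sobolev_ops_meixner_sobolev unfolding ops_def is_meixner_sobolev_ops_def .
  show "lead_coeff (meixner n \<beta> c) \<noteq> 0" for n
    using c coeff_meixner[of n \<beta> c] by auto
qed

text \<open>Split by \<open>meixner_Suc_diff\<close>: the part of degree \<open>Suc n\<close> is
  orthogonal to \<open>g\<close>, and the difference term pairs \<open>meixner n\<close> with
  \<open>diff_poly g\<close>, of degree below \<open>n\<close>. The surviving term matters only for
  \<open>g\<close> of degree exactly \<open>n\<close>, where it fixes the sign of
  \<open>a\<close>.\<close>

lemma meixner_sobolev_inner_meixner:
  assumes "\<forall>i\<ge>Suc n. coeff g i = 0"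
  shows "meixner_sobolev_inner \<beta> c lam (meixner (Suc n) (\<beta> - 1) c) g
    = - meixner_functional \<beta> c (meixner n \<beta> c * g)"
proof -
  have "meixner_functional \<beta> c (meixner (Suc n) (\<beta> - 1) c * g)
      = meixner_functional \<beta> c (meixner (Suc n) \<beta> c * g) - meixner_functional \<beta> c (meixner n \<beta> c * g)"
    using \<beta> c by (simp add: meixner_Suc_diff[symmetric] left_diff_distrib meixner_functional_diff)
  moreover have "meixner_functional \<beta> c (meixner (Suc n) \<beta> c * g) = 0"
    using meixner_orthogonal[OF \<beta> c] assms by blast
  moreover have "meixner_functional \<beta> c (meixner n \<beta> c * diff_poly g) = 0"
    using meixner_orthogonal[OF \<beta> c] coeff_diff_poly_eq_0[OF assms] by blast
  ultimately show ?thesis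
    using \<beta> c by (simp add: meixner_sobolev_inner_eq diff_poly_meixner_Suc meixner_functional_smult)
qed

lemma ex_meixner_sobolev_coeff:
  "\<exists>a>0. meixner (Suc n) (\<beta> - 1) c
      = meixner_sobolev \<beta> c lam (Suc n) - smult a (meixner_sobolev \<beta> c lam n)"
proof -
  let ?B = "meixner_sobolev_inner \<beta> c lam" and ?S = "meixner_sobolev \<beta> c lam"
  let ?m = "meixner (Suc n) (\<beta> - 1) c"
  define d where "d = ?S (Suc n) - ?m"
  have d: "coeff d i = 0" if "i > n" for i
  proof (cases "i = Suc n")
    case True
    then show ?thesis
      by (simp add: d_def coeff_meixner_sobolev coeff_meixner)
  next
    case False
    then show ?thesis
      using that c by (simp add: d_def coeff_eq_0 degree_meixner_sobolev degree_meixner)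
  qed
  \<comment> \<open>This choice cancels the coefficient of degree \<open>n\<close>, so
    \<open>e\<close> has degree below \<open>n\<close> and is orthogonal to every summand defining
    it.\<close>
  define a where "a = coeff d n / coeff (?S n) n"
  define e where "e = d - smult a (?S n)"
  have "coeff (?S n) n \<noteq> 0"
    using c by (simp add: coeff_meixner_sobolev)
  then have e0: "\<forall>i\<ge>n. coeff e i = 0"
    using d by (auto simp: e_def a_def coeff_eq_0 degree_meixner_sobolev dest: le_imp_less_or_eq)
  have "?B (?S (Suc n)) e = 0" "?B (?S n) e = 0"
    using e0 by (auto intro!: meixner_sobolev_orthogonal_lower)
  moreover have "?B ?m e = 0"
    using meixner_sobolev_inner_meixner[of n e] meixner_orthogonal[OF \<beta> c, of n e] e0 by simp
  ultimately have "?B e e = 0"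
    unfolding e_def d_def by (simp add: diff_left smult_left)
  then have d_eq: "d = smult a (?S n)"
    by (simp add: self_eq_0_iff e_def)
  have Sn: "\<forall>i\<ge>Suc n. coeff (?S n) i = 0"
    by (simp add: coeff_eq_0 degree_meixner_sobolev)
  have "a * ?B (?S n) (?S n) = ?B d (?S n)"
    by (simp add: d_eq smult_left)
  also have "\<dots> = - ?B ?m (?S n)"
    using meixner_sobolev_orthogonal_lower[OF Sn] by (simp add: d_def diff_left)
  also have "\<dots> = meixner_functional \<beta> c (meixner n \<beta> c * ?S n)"
    using meixner_sobolev_inner_meixner[OF Sn] by simp
  \<comment> \<open>\<open>?S n\<close> and \<open>meixner n\<close> share their leading
    coefficient, so their difference is annihilated by \<open>meixner n\<close>.\<close>
  also have "\<dots> = meixner_functional \<beta> c (meixner n \<beta> c * meixner n \<beta> c)"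
  proof -
    have "coeff (?S n - meixner n \<beta> c) i = 0" if "i \<ge> n" for i
      using that c by (cases "i = n")
        (simp_all add: coeff_meixner_sobolev coeff_meixner coeff_eq_0 degree_meixner_sobolev degree_meixner)
    then have "meixner_functional \<beta> c (meixner n \<beta> c * (?S n - meixner n \<beta> c)) = 0"
      using meixner_orthogonal[OF \<beta> c] by blast
    then show ?thesis
      using \<beta> c by (simp add: right_diff_distrib meixner_functional_diff)
  qed
  finally have "a * ?B (?S n) (?S n) = meixner_functional \<beta> c (meixner n \<beta> c * meixner n \<beta> c)" .
  moreover have "meixner n \<beta> c \<noteq> 0"
    using c coeff_meixner[of n \<beta> c] by auto
  ultimately have "a * ?B (?S n) (?S n) > 0"
    using meixner_functional_square_pos[OF \<beta> c] by simp
  then have "a > 0"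
    using pos[OF meixner_sobolev_nonzero, of n] by (rule zero_less_mult_pos2)
  moreover have "?m = ?S (Suc n) - smult a (?S n)"
    using d_eq by (simp add: d_def algebra_simps)
  ultimately show ?thesis by blast
qed

text \<open>Existence is the previous lemma; \<open>a\<close> is unique because the Sobolev
  polynomial of degree \<open>n\<close> is nonzero.\<close>

lemma meixner_sobolev_coeff:
  shows "meixner_sobolev_coeff \<beta> c lam n > 0"
    and "meixner (Suc n) (\<beta> - 1) c = meixner_sobolev \<beta> c lam (Suc n)
      - smult (meixner_sobolev_coeff \<beta> c lam n) (meixner_sobolev \<beta> c lam n)"
proof -
  let ?P = "\<lambda>a. a > 0 \<and> meixner (Suc n) \<beta> c - meixner n \<beta> c
      = meixner_sobolev \<beta> c lam (Suc n) - smult a (meixner_sobolev \<beta> c lam n)"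
  have "a = b" if "?P a" "?P b" for a b
  proof -
    have "smult (a - b) (meixner_sobolev \<beta> c lam n) = 0"
      using that by (simp add: smult_diff_left)
    then show ?thesis
      using meixner_sobolev_nonzero[of n] by simp
  qed
  then have "\<exists>!a. ?P a"
    using ex_meixner_sobolev_coeff[of n] unfolding meixner_Suc_diff by blast
  then have "?P (meixner_sobolev_coeff \<beta> c lam n)"
    unfolding meixner_sobolev_coeff_def by (rule theI')
  then show "meixner_sobolev_coeff \<beta> c lam n > 0"
    and "meixner (Suc n) (\<beta> - 1) c = meixner_sobolev \<beta> c lam (Suc n)
      - smult (meixner_sobolev_coeff \<beta> c lam n) (meixner_sobolev \<beta> c lam n)"
    by (simp_all add: meixner_Suc_diff)
qed

lemma meixner_sobolev_0: "meixner_sobolev \<beta> c lam 0 = 1"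
proof -
  obtain d where d: "meixner_sobolev \<beta> c lam 0 = [:d:]"
    using degree_meixner_sobolev[of 0] by (rule degree_eq_zeroE)
  then have "d = 1"
    using coeff_meixner_sobolev[of 0] by simp
  then show ?thesis
    using d by (simp add: one_pCons)
qed

end

section \<open>The generating function\<close>

theorem proposition3p5:
  fixes \<beta> c lam \<eta> x :: real
  assumes "\<beta> > 0" and "0 < c" and "c < 1" and "lam > 0"
    and "\<eta> = 1 + lam * (1 - 1 / c)\<^sup>2"
  shows "Abs_fps (\<lambda>n. meixner_sobolev_q \<beta> c \<eta> n * poly (meixner_sobolev \<beta> c lam n) x)
       = 1 / (1 - fps_X) * Abs_fps (\<lambda>n. meixner_sobolev_q \<beta> c \<eta> n * poly (meixner n (\<beta> - 1) c) x)"
    (is "?F = _ * ?G")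
proof -
  note pars = assms(1-4)
  let ?q = "meixner_sobolev_q \<beta> c \<eta>" and ?a = "meixner_sobolev_coeff \<beta> c lam"
  \<comment> \<open>The recursion for \<open>q\<close> recovers \<open>lam\<close> from
    \<open>\<eta>\<close>, as \<open>c < 1\<close> makes \<open>1 - 1 / c\<close> nonzero.\<close>
  have "(\<eta> - 1) / (1 - 1 / c)\<^sup>2 = lam"
    using assms by simp
  then have q: "?q (Suc n) * ?a n = ?q n" for n
    using meixner_sobolev_coeff(1)[OF pars, of n] by simp
  \<comment> \<open>Multiplication by \<open>1 - fps_X\<close> takes differences of consecutive
    coefficients; \<open>q\<close> converts the factor \<open>?q (Suc k) * ?a k\<close> into
    \<open>?q k\<close>.\<close>
  have "(1 - fps_X) * ?F = ?G"
  proof (rule fps_ext)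
    fix n
    show "((1 - fps_X) * ?F) $ n = ?G $ n"
    proof (cases n)
      case 0
      then show ?thesis
        by (simp add: left_diff_distrib meixner_sobolev_0[OF pars])
    next
      case (Suc k)
      have "poly (meixner (Suc k) (\<beta> - 1) c) x
          = poly (meixner_sobolev \<beta> c lam (Suc k)) x - ?a k * poly (meixner_sobolev \<beta> c lam k) x"
        by (simp add: meixner_sobolev_coeff(2)[OF pars])
      then have "?q (Suc k) * poly (meixner (Suc k) (\<beta> - 1) c) x
          = ?q (Suc k) * poly (meixner_sobolev \<beta> c lam (Suc k)) x
            - (?q (Suc k) * ?a k) * poly (meixner_sobolev \<beta> c lam k) x"
        by (simp only: right_diff_distrib mult.assoc)
      then show ?thesis
        unfolding Suc q by (simp add: left_diff_distrib del: meixner_sobolev_q.simps)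
    qed
  qed
  then have "1 / (1 - fps_X) * ?G = (1 / (1 - fps_X) * (1 - fps_X)) * ?F"
    by (simp only: mult.assoc)
  \<comment> \<open>\<open>1 - fps_X\<close> is a unit, its constant coefficient being
    \<open>1\<close>.\<close>
  also have "1 / (1 - fps_X) * (1 - fps_X) = (1 :: real fps)"
    by (simp add: fps_divide_unit inverse_mult_eq_1)
  finally show ?thesis
    by simp
qed

end
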